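(* Let $X,Y$ be real Hilbert spaces, $A\in L(X,Y)$, $\alpha>0$ and $R(x)=\frac12\|x\|^2$. Let $(y_k)\subset Y$ be a sequence with $y_k\to\hat y\in Y$. Assume that the ADP solutions $x_k$ corresponding to the data $y_k$ and $\hat x$ corresponding to the data $\hat y$ are unique and fulfill the norm constraint with equality, i.e. $\|x_k\|^2=\frac{\|y_k\|^2}{4\alpha}$ for all $k$ and $\|\hat x\|^2=\frac{\|\hat y\|^2}{4\alpha}$. Then ADP is stable, i.e. $x_k\to\hat x$ in $X$.
   Context: $L(X,Y)$ is the space of bounded linear operators. For data $y\in Y$ and $R(x)=\frac12\|x\|^2$, the ADP problem is $$\min_{B\in L(X,Y)}\ \frac12\|Ax(B)-y\|^2\quad\text{s.t.}\quad x(B)=\arg\min_{x\in X}\frac12\|Bx-y\|^2+\frac{\alpha}{2}\|x\|^2,$$ which has the equivalent formulation $$\min_{x\in X}\frac12\|Ax-y\|^2\quad\text{s.t.}\quad\|x\|^2\le\frac{\|y\|^2}{4\alpha}.$$ An ADP solution for data $y$ is an element $x\in X$ solving this latter problem (equivalently, $x=x(B)$ for a minimizing $B$). *)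

theory Defs
  imports "HOL-Analysis.Analysis"
begin

text \<open>
  The regulariser is fixed to $R(x) = \frac12\|x\|^2$. For this choice the bilevel problem of
  minimising $\frac12\|A\,x(B) - y\|^2$ over bounded linear operators $B$ is equivalent to the
  norm-constrained problem below, whose solutions are called the ADP solutions for the data $y$.
\<close>

definition ADP_solution ::
  "('a::{real_inner, complete_space} \<Rightarrow>\<^sub>L 'b::{real_inner, complete_space}) \<Rightarrow> real \<Rightarrow> 'b \<Rightarrow> 'a \<Rightarrow> bool"
  where
  "ADP_solution A \<alpha> y x \<longleftrightarrow>
     is_arg_min (\<lambda>x. 1/2 * (norm (blinfun_apply A x - y))\<^sup>2)
                (\<lambda>x. (norm x)\<^sup>2 \<le> (norm y)\<^sup>2 / (4 * \<alpha>)) x"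

end

theory Submission
  imports Defs
begin

text \<open>
  The usual argument extracts a weakly convergent subsequence of \<open>x\<close>, identifies its limit as the
  unique solution \<open>x_hat\<close> by weak lower semicontinuity, and upgrades to strong convergence because
  the norms converge as well. The proof below is elementary and needs neither weak topologies nor
  subsequences.

  Let \<open>r = norm x_hat\<close> and let \<open>m = norm (A x_hat - y_hat)\<close> be the optimal residual. The relaxed
  sets of all \<open>v\<close> with \<open>norm v \<le> r + 1/(n+1)\<close> and \<open>norm (A v - y_hat) \<le> m + 1/(n+1)\<close> are closed,
  convex and decreasing in \<open>n\<close>, and their intersection consists of the solutions for the data
  \<open>y_hat\<close>, so by uniqueness it is the singleton of \<open>x_hat\<close>. The active constraint gives
  \<open>norm (x k) \<longlonglongrightarrow> r\<close>. Comparing \<open>x k\<close> with the rescaling of \<open>x_hat\<close> to the norm of \<open>x k\<close>, a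
  feasible point for the data \<open>y k\<close>, shows that \<open>x k\<close> eventually lies in each relaxed set. The
  conclusion is then the general fact \<open>tendsto_of_nested_convex\<close> on decreasing sequences of closed
  convex sets, which plays the role of weak compactness together with the Radon--Riesz property
  and rests on the parallelogram law and completeness.
\<close>

text \<open>If every point of a convex set has squared norm at least \<open>d\<close>, then two of its points whose
  squared norms are close to \<open>d\<close> are close to each other.\<close>

lemma convex_norm_diff_le:
  fixes u v :: "'a::real_inner"
  assumes "convex C" "u \<in> C" "v \<in> C" and d: "\<And>w. w \<in> C \<Longrightarrow> d \<le> (norm w)\<^sup>2"
  shows "(norm (u - v))\<^sup>2 \<le> 2 * (norm u)\<^sup>2 + 2 * (norm v)\<^sup>2 - 4 * d"
proof -
  have "(1/2) *\<^sub>R u + (1/2) *\<^sub>R v \<in> C"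
    using assms(1-3) by (intro convexD) auto
  then have "4 * d \<le> 4 * (norm ((1/2) *\<^sub>R (u + v)))\<^sup>2"
    using d by (simp add: scaleR_add_right)
  also have "\<dots> = (norm (u + v))\<^sup>2"
    by (simp add: power_divide)
  also have "\<dots> = 2 * (norm u)\<^sup>2 + 2 * (norm v)\<^sup>2 - (norm (u - v))\<^sup>2"
    by (simp add: power2_norm_eq_inner algebra_simps inner_commute)
  finally show ?thesis by simp
qed

text \<open>Decreasing closed convex sets whose intersection is \<open>{a}\<close> determine \<open>a\<close> as the limit of the
  (almost) least-norm points of the sets. Hence the least norms increase to \<open>norm a\<close>, and any
  sequence that eventually enters each set and whose norms tend to \<open>norm a\<close> is asymptotically of
  least norm too, which forces it to converge to \<open>a\<close>.\<close>

lemma tendsto_of_nested_convex: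
  fixes K :: "nat \<Rightarrow> 'a::{real_inner, complete_space} set"
  assumes conv: "\<And>n. convex (K n)" and clo: "\<And>n. closed (K n)" and dec: "decseq K"
    and int: "(\<Inter>n. K n) = {a}"
    and ev: "\<And>n. \<forall>\<^sub>F k in sequentially. z k \<in> K n"
    and nz: "(\<lambda>k. norm (z k)) \<longlonglongrightarrow> norm a"
  shows "z \<longlonglongrightarrow> a"
proof -
  define d where "d n = (INF w\<in>K n. (norm w)\<^sup>2)" for n
  have aK: "a \<in> K n" for n using int by auto
  have sub: "K j \<subseteq> K n" if "n \<le> j" for n j using dec that by (simp add: decseq_def)
  have bdd: "bdd_below ((\<lambda>w. (norm w)\<^sup>2) ` K n)" for n
    by (rule bdd_belowI2[where m = 0]) simp
  have d_le: "d n \<le> (norm w)\<^sup>2" if "w \<in> K n" for n w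
    unfolding d_def using bdd that by (rule cINF_lower)
  have "d n \<le> d j" if "n \<le> j" for n j
    unfolding d_def[of j]
    by (rule cINF_greatest) (use aK[of j] sub[OF that] d_le in auto)
  then have "incseq d"
    by (simp add: incseq_def)
  then obtain D where D: "d \<longlonglongrightarrow> D" and dD: "\<And>n. d n \<le> D"
    using incseq_convergent[of d "(norm a)\<^sup>2"] d_le[OF aK] by auto
  have "\<exists>w\<in>K n. (norm w)\<^sup>2 < d n + 1 / real (Suc n)" for n
    using cINF_less_iff[OF _ bdd, of n "d n + 1 / real (Suc n)"] aK[of n]
    unfolding d_def by auto
  then obtain p where pK: "\<And>n. p n \<in> K n"
      and p: "\<And>n. (norm (p n))\<^sup>2 < d n + 1 / real (Suc n)"
    by metis
  have diff: "(norm (p n - p j))\<^sup>2 \<le> 4 / real (Suc n) + 2 * (D - d n)" if "n \<le> j" for n j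
  proof -
    have "(norm (p n - p j))\<^sup>2 \<le> 2 * (norm (p n))\<^sup>2 + 2 * (norm (p j))\<^sup>2 - 4 * d n"
      using pK[of n] pK[of j] sub[OF that] by (intro convex_norm_diff_le[OF conv[of n]] d_le) auto
    moreover have "1 / real (Suc j) \<le> 1 / real (Suc n)"
      using that by (simp add: frac_le)
    ultimately show ?thesis
      using p[of n] p[of j] dD[of j] by simp
  qed
  have inv: "(\<lambda>n. 1 / real (Suc n)) \<longlonglongrightarrow> 0"
    using LIMSEQ_inverse_real_of_nat by (simp add: inverse_eq_divide)
  have small: "(\<lambda>n. 4 / real (Suc n) + 2 * (D - d n)) \<longlonglongrightarrow> 0"
    using tendsto_add[OF tendsto_mult_left[OF inv, of 4]
        tendsto_mult_left[OF tendsto_diff[OF tendsto_const[of D] D], of 2]]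
    by simp
  have "Cauchy p"
  proof (rule metric_CauchyI)
    fix e :: real assume e: "0 < e"
    then have "\<forall>\<^sub>F n in sequentially. 4 / real (Suc n) + 2 * (D - d n) < (e/2)\<^sup>2"
      by (intro order_tendstoD(2)[OF small]) simp
    then obtain N where "4 / real (Suc N) + 2 * (D - d N) < (e/2)\<^sup>2"
      by (auto simp: eventually_sequentially)
    then have "(norm (p N - p j))\<^sup>2 < (e/2)\<^sup>2" if "N \<le> j" for j
      using diff[OF that] by linarith
    then have near: "dist (p N) (p j) < e/2" if "N \<le> j" for j
      using that e power2_less_imp_less[of _ "e/2"] by (simp add: dist_norm)
    have "dist (p i) (p j) < e" if "N \<le> i" "N \<le> j" for i j
      using near[OF that(1)] near[OF that(2)] by (metis dist_commute dist_triangle_half_l)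
    then show "\<exists>M. \<forall>i\<ge>M. \<forall>j\<ge>M. dist (p i) (p j) < e" by blast
  qed
  then obtain b where b: "p \<longlonglongrightarrow> b"
    by (auto simp: Cauchy_convergent_iff convergent_def)
  have "b \<in> K n" for n
  proof (rule Lim_in_closed_set[OF clo _ _ b])
    show "\<forall>\<^sub>F j in sequentially. p j \<in> K n"
      unfolding eventually_sequentially using sub pK by blast
  qed simp
  then have "b = a" using int by auto
  with b have pa: "p \<longlonglongrightarrow> a" by simp
  have "(norm a)\<^sup>2 \<le> D + 0"
  proof (rule tendsto_le[OF _ tendsto_add[OF D inv]])
    show "(\<lambda>n. (norm (p n))\<^sup>2) \<longlonglongrightarrow> (norm a)\<^sup>2"
      by (intro tendsto_intros pa)
    show "\<forall>\<^sub>F n in sequentially. (norm (p n))\<^sup>2 \<le> d n + 1 / real (Suc n)"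
      by (intro always_eventually allI less_imp_le p)
  qed simp
  then have aD: "(norm a)\<^sup>2 \<le> D" by simp
  have "(\<lambda>k. (norm (z k - a))\<^sup>2) \<longlonglongrightarrow> 0"
  proof (rule order_tendstoI)
    fix e :: real assume e: "0 < e"
    have "\<forall>\<^sub>F n in sequentially. D - e/8 < d n"
      using e by (intro order_tendstoD(1)[OF D]) simp
    then obtain n where n: "D - e/8 < d n"
      by (auto simp: eventually_sequentially)
    have "(\<lambda>k. (norm (z k))\<^sup>2) \<longlonglongrightarrow> (norm a)\<^sup>2"
      by (intro tendsto_intros nz)
    then have "\<forall>\<^sub>F k in sequentially. (norm (z k))\<^sup>2 < (norm a)\<^sup>2 + e/4"
      using e by (intro order_tendstoD(2)) auto
    with ev[of n] show "\<forall>\<^sub>F k in sequentially. (norm (z k - a))\<^sup>2 < e"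
    proof eventually_elim
      case (elim k)
      have "(norm (z k - a))\<^sup>2 \<le> 2 * (norm (z k))\<^sup>2 + 2 * (norm a)\<^sup>2 - 4 * d n"
        using elim(1) aK by (intro convex_norm_diff_le[OF conv[of n]] d_le) auto
      then show ?case using elim(2) n aD by linarith
    qed
  next
    fix e :: real assume "e < 0"
    then show "\<forall>\<^sub>F k in sequentially. e < (norm (z k - a))\<^sup>2"
      by (intro always_eventually allI) (rule less_le_trans, auto)
  qed
  then have "(\<lambda>k. sqrt ((norm (z k - a))\<^sup>2)) \<longlonglongrightarrow> sqrt 0"
    by (rule tendsto_real_sqrt)
  then show ?thesis
    by (simp add: tendsto_norm_zero_iff LIM_zero_iff)
qed

lemma ADP_solution_iff:
  "ADP_solution A \<alpha> y x \<longleftrightarrow> (norm x)\<^sup>2 \<le> (norm y)\<^sup>2 / (4 * \<alpha>) \<and>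
     (\<forall>u. (norm u)\<^sup>2 \<le> (norm y)\<^sup>2 / (4 * \<alpha>) \<longrightarrow>
        norm (blinfun_apply A x - y) \<le> norm (blinfun_apply A u - y))"
  by (auto simp: ADP_solution_def is_arg_min_def not_less intro: power2_le_imp_le power_mono)

theorem theorem3p8:
  fixes A :: "'a::{real_inner, complete_space} \<Rightarrow>\<^sub>L 'b::{real_inner, complete_space}"
    and \<alpha> :: real
    and y :: "nat \<Rightarrow> 'b" and y_hat :: 'b
    and x :: "nat \<Rightarrow> 'a" and x_hat :: 'a
  assumes "\<alpha> > 0"
    and "y \<longlonglongrightarrow> y_hat"
    and "\<And>k. ADP_solution A \<alpha> (y k) (x k)"
    and "\<And>k. \<exists>!z. ADP_solution A \<alpha> (y k) z"
    and "ADP_solution A \<alpha> y_hat x_hat"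
    and "\<exists>!z. ADP_solution A \<alpha> y_hat z"
    and "\<And>k. (norm (x k))\<^sup>2 = (norm (y k))\<^sup>2 / (4 * \<alpha>)"
    and "(norm x_hat)\<^sup>2 = (norm y_hat)\<^sup>2 / (4 * \<alpha>)"
  shows "x \<longlonglongrightarrow> x_hat"
proof -
  define m where "m = norm (A x_hat - y_hat)"
  define K where "K n = cball 0 (norm x_hat + 1 / real (Suc n)) \<inter>
      blinfun_apply A -` cball y_hat (m + 1 / real (Suc n))" for n
  have inv: "(\<lambda>n. c + 1 / real (Suc n)) \<longlonglongrightarrow> c" for c :: real
    using tendsto_add[OF tendsto_const LIMSEQ_inverse_real_of_nat, of c]
    by (simp add: inverse_eq_divide)

  have "(\<lambda>k. sqrt ((norm (x k))\<^sup>2)) \<longlonglongrightarrow> sqrt ((norm x_hat)\<^sup>2)"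
    unfolding assms(7,8) using assms(1,2) by (intro tendsto_intros) auto
  then have nx: "(\<lambda>k. norm (x k)) \<longlonglongrightarrow> norm x_hat" by simp

  \<comment> \<open>The competitor for the data \<open>y k\<close>; if \<open>x_hat = 0\<close>, it is \<open>0\<close> and still feasible.\<close>
  define u where "u k = (norm (x k) / norm x_hat) *\<^sub>R x_hat" for k
  have u: "u \<longlonglongrightarrow> x_hat"
  proof (cases "x_hat = 0")
    case False
    then have "(\<lambda>k. norm (x k) / norm x_hat) \<longlonglongrightarrow> 1"
      using tendsto_divide[OF nx tendsto_const[of "norm x_hat"]] by simp
    from tendsto_scaleR[OF this tendsto_const[of x_hat]] show ?thesis
      by (simp add: u_def[abs_def])
  qed (simp add: u_def[abs_def])
  have "norm (u k) \<le> norm (x k)" for k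
    by (cases "x_hat = 0") (auto simp: u_def)
  then have "(norm (u k))\<^sup>2 \<le> (norm (y k))\<^sup>2 / (4 * \<alpha>)" for k
    unfolding assms(7)[symmetric] by (simp add: power_mono)
  then have opt: "norm (A (x k) - y k) \<le> norm (A (u k) - y k)" for k
    using assms(3)[of k] by (simp add: ADP_solution_iff)
  have "(\<lambda>k. norm (A (u k) - y k) + norm (y k - y_hat)) \<longlonglongrightarrow> m + norm (y_hat - y_hat)"
    unfolding m_def by (intro tendsto_intros u assms(2))
  then have res: "(\<lambda>k. norm (A (u k) - y k) + norm (y k - y_hat)) \<longlonglongrightarrow> m" by simp

  show ?thesis
  proof (rule tendsto_of_nested_convex[where K = K, OF _ _ _ _ _ nx])
    show "convex (K n)" for n
      unfolding K_def
      by (intro convex_Int convex_cball convex_linear_vimage)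
        (simp add: bounded_linear.linear blinfun.bounded_linear_right)
    show "closed (K n)" for n
      unfolding K_def
      by (intro closed_Int closed_cball continuous_closed_vimage)
        (auto intro: continuous_intros)
    have "K j \<subseteq> K n" if "n \<le> j" for n j
    proof -
      have "1 / real (Suc j) \<le> 1 / real (Suc n)"
        using that by (simp add: frac_le)
      then show ?thesis unfolding K_def by auto
    qed
    then show "decseq K" by (simp add: decseq_def)
    show "(\<Inter>n. K n) = {x_hat}"
    proof (intro equalityI subsetI)
      fix v assume "v \<in> (\<Inter>n. K n)"
      then have v: "norm v \<le> norm x_hat + 1 / real (Suc n)"
          "norm (A v - y_hat) \<le> m + 1 / real (Suc n)" for n
        by (auto simp: K_def dist_norm norm_minus_commute)
      have nv: "norm v \<le> norm x_hat" and rv: "norm (A v - y_hat) \<le> m"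
        using v by (auto intro!: LIMSEQ_le_const[OF inv])
      have "(norm v)\<^sup>2 \<le> (norm y_hat)\<^sup>2 / (4 * \<alpha>)"
        using power_mono[OF nv, of 2] assms(8) by simp
      moreover have "norm (A v - y_hat) \<le> norm (A w - y_hat)"
        if "(norm w)\<^sup>2 \<le> (norm y_hat)\<^sup>2 / (4 * \<alpha>)" for w
        using rv assms(5) that unfolding ADP_solution_iff m_def by (meson order_trans)
      ultimately have "ADP_solution A \<alpha> y_hat v"
        unfolding ADP_solution_iff by blast
      then show "v \<in> {x_hat}" using assms(5,6) by auto
    qed (auto simp: K_def m_def dist_norm norm_minus_commute)
    show "\<forall>\<^sub>F k in sequentially. x k \<in> K n" for n
    proof -
      have "\<forall>\<^sub>F k in sequentially. norm (x k) < norm x_hat + 1 / real (Suc n)"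
        by (rule order_tendstoD(2)[OF nx]) simp
      moreover have "\<forall>\<^sub>F k in sequentially.
          norm (A (u k) - y k) + norm (y k - y_hat) < m + 1 / real (Suc n)"
        by (rule order_tendstoD(2)[OF res]) simp
      ultimately show ?thesis
      proof eventually_elim
        case (elim k)
        have "norm (A (x k) - y_hat) \<le> norm (A (x k) - y k) + norm (y k - y_hat)"
          using norm_triangle_ineq[of "A (x k) - y k" "y k - y_hat"] by simp
        then show ?case
          using elim opt[of k] by (simp add: K_def dist_norm norm_minus_commute)
      qed
    qed
  qed
qed

end
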